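(* For every finite Heyting algebra $H$, either $\mathrm{ds}_H(p \vee \neg p = \top) = 1$ or $\mathrm{ds}_H(p \vee \neg p = \top) \leq \frac{2}{3}$. That is, the equation $p \vee \neg p = \top$ has finite satisfiability gap $\frac{1}{3}$ in the class of Heyting algebras.
   Context: For a Heyting algebra $H$, $\neg x$ abbreviates $x \to \bot$. For a finite structure $M$ and a formula $\varphi(x_1,\dots,x_n)$, the degree of satisfiability $\mathrm{ds}_M(\varphi)$ is $|\{(a_1,\dots,a_n)\in M^n : M \models \varphi(a_1,\dots,a_n)\}| / |M|^n$. A formula $\varphi$ has finite satisfiability gap $\varepsilon>0$ in a theory $T$ if for every finite model $M$ of $T$, either $\mathrm{ds}_M(\varphi)=1$ or $\mathrm{ds}_M(\varphi)\le 1-\varepsilon$. *)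

theory Defs
  imports Complex_Main "HOL-Library.FuncSet"
begin

record 'a hstruct =
  carrier :: "'a set"
  meet :: "'a \<Rightarrow> 'a \<Rightarrow> 'a"
  join :: "'a \<Rightarrow> 'a \<Rightarrow> 'a"
  imp :: "'a \<Rightarrow> 'a \<Rightarrow> 'a"
  bot :: 'a
  top :: 'a

locale hstructure =
  fixes H :: "'a hstruct"
  assumes meet_closed: "x \<in> carrier H \<Longrightarrow> y \<in> carrier H \<Longrightarrow> meet H x y \<in> carrier H"
    and join_closed: "x \<in> carrier H \<Longrightarrow> y \<in> carrier H \<Longrightarrow> join H x y \<in> carrier H"
    and imp_closed: "x \<in> carrier H \<Longrightarrow> y \<in> carrier H \<Longrightarrow> imp H x y \<in> carrier H"
    and bot_closed: "bot H \<in> carrier H"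
    and top_closed: "top H \<in> carrier H"

definition hle :: "'a hstruct \<Rightarrow> 'a \<Rightarrow> 'a \<Rightarrow> bool" where
  "hle H x y \<longleftrightarrow> meet H x y = x"

locale heyting_algebra = hstructure H for H :: "'a hstruct" +
  assumes meet_assoc: "\<lbrakk>x \<in> carrier H; y \<in> carrier H; z \<in> carrier H\<rbrakk> \<Longrightarrow>
      meet H (meet H x y) z = meet H x (meet H y z)"
    and join_assoc: "\<lbrakk>x \<in> carrier H; y \<in> carrier H; z \<in> carrier H\<rbrakk> \<Longrightarrow>
      join H (join H x y) z = join H x (join H y z)"
    and meet_comm: "\<lbrakk>x \<in> carrier H; y \<in> carrier H\<rbrakk> \<Longrightarrow> meet H x y = meet H y x"
    and join_comm: "\<lbrakk>x \<in> carrier H; y \<in> carrier H\<rbrakk> \<Longrightarrow> join H x y = join H y x"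
    and meet_absorb: "\<lbrakk>x \<in> carrier H; y \<in> carrier H\<rbrakk> \<Longrightarrow> meet H x (join H x y) = x"
    and join_absorb: "\<lbrakk>x \<in> carrier H; y \<in> carrier H\<rbrakk> \<Longrightarrow> join H x (meet H x y) = x"
    and bot_least: "x \<in> carrier H \<Longrightarrow> hle H (bot H) x"
    and top_greatest: "x \<in> carrier H \<Longrightarrow> hle H x (top H)"
    and residuation: "\<lbrakk>x \<in> carrier H; y \<in> carrier H; z \<in> carrier H\<rbrakk> \<Longrightarrow>
      hle H (meet H z x) y \<longleftrightarrow> hle H z (imp H x y)"

datatype hterm = Var nat | Bot | Top | Meet hterm hterm | Join hterm hterm | Imp hterm hterm

abbreviation Neg :: "hterm \<Rightarrow> hterm" where
  "Neg t \<equiv> Imp t Bot"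

datatype hform =
    Eq hterm hterm
  | FNot hform
  | FAnd hform hform
  | FOr hform hform
  | FImp hform hform
  | FAll nat hform
  | FEx nat hform

primrec tvars :: "hterm \<Rightarrow> nat set" where
  "tvars (Var i) = {i}"
| "tvars Bot = {}"
| "tvars Top = {}"
| "tvars (Meet s t) = tvars s \<union> tvars t"
| "tvars (Join s t) = tvars s \<union> tvars t"
| "tvars (Imp s t) = tvars s \<union> tvars t"

primrec fvars :: "hform \<Rightarrow> nat set" where
  "fvars (Eq s t) = tvars s \<union> tvars t"
| "fvars (FNot p) = fvars p"
| "fvars (FAnd p q) = fvars p \<union> fvars q"
| "fvars (FOr p q) = fvars p \<union> fvars q"
| "fvars (FImp p q) = fvars p \<union> fvars q"
| "fvars (FAll i p) = fvars p - {i}"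
| "fvars (FEx i p) = fvars p - {i}"

primrec teval :: "'a hstruct \<Rightarrow> (nat \<Rightarrow> 'a) \<Rightarrow> hterm \<Rightarrow> 'a" where
  "teval M e (Var i) = e i"
| "teval M e Bot = bot M"
| "teval M e Top = top M"
| "teval M e (Meet s t) = meet M (teval M e s) (teval M e t)"
| "teval M e (Join s t) = join M (teval M e s) (teval M e t)"
| "teval M e (Imp s t) = imp M (teval M e s) (teval M e t)"

primrec sat :: "'a hstruct \<Rightarrow> (nat \<Rightarrow> 'a) \<Rightarrow> hform \<Rightarrow> bool" where
  "sat M e (Eq s t) \<longleftrightarrow> teval M e s = teval M e t"
| "sat M e (FNot p) \<longleftrightarrow> \<not> sat M e p"
| "sat M e (FAnd p q) \<longleftrightarrow> sat M e p \<and> sat M e q"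
| "sat M e (FOr p q) \<longleftrightarrow> sat M e p \<or> sat M e q"
| "sat M e (FImp p q) \<longleftrightarrow> (sat M e p \<longrightarrow> sat M e q)"
| "sat M e (FAll i p) \<longleftrightarrow> (\<forall>x\<in>carrier M. sat M (e(i := x)) p)"
| "sat M e (FEx i p) \<longleftrightarrow> (\<exists>x\<in>carrier M. sat M (e(i := x)) p)"

text \<open>Axioms with free variables are read as their universal closures.\<close>

definition models :: "'a hstruct \<Rightarrow> hform set \<Rightarrow> bool" where
  "models M T \<longleftrightarrow> hstructure M \<and>
     (\<forall>\<phi>\<in>T. \<forall>e. (\<forall>i. e i \<in> carrier M) \<longrightarrow> sat M e \<phi>)"

text \<open>Here \<open>\<phi>\<close> is read as \<open>\<phi>(x\<^sub>0, \<dots>, x\<^sub>n\<^sub>-\<^sub>1)\<close>, which is meaningful when its free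
  variables are among \<open>Var 0, \<dots>, Var (n - 1)\<close>; the extensional functions
  \<open>{..<n} \<rightarrow>\<^sub>E carrier M\<close> are the \<open>n\<close>-tuples over \<open>M\<close>.\<close>

definition ds :: "'a hstruct \<Rightarrow> nat \<Rightarrow> hform \<Rightarrow> real" where
  "ds M n \<phi> =
     real (card {a \<in> {..<n} \<rightarrow>\<^sub>E carrier M. sat M a \<phi>}) / real (card (carrier M)) ^ n"

text \<open>The type argument is the type from which the universes of models are drawn.\<close>

definition finite_sat_gap :: "'a itself \<Rightarrow> hform set \<Rightarrow> nat \<Rightarrow> hform \<Rightarrow> real \<Rightarrow> bool" where
  "finite_sat_gap (_ :: 'a itself) T n \<phi> \<epsilon> \<longleftrightarrow>
     fvars \<phi> \<subseteq> {..<n} \<and> \<epsilon> > 0 \<and>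
     (\<forall>M :: 'a hstruct. models M T \<and> finite (carrier M) \<longrightarrow>
        ds M n \<phi> = 1 \<or> ds M n \<phi> \<le> 1 - \<epsilon>)"

abbreviation Le :: "hterm \<Rightarrow> hterm \<Rightarrow> hform" where
  "Le s t \<equiv> Eq (Meet s t) s"

definition heyting_theory :: "hform set" where
  "heyting_theory = (let x = Var 0; y = Var 1; z = Var 2 in
    {Eq (Meet (Meet x y) z) (Meet x (Meet y z)),
     Eq (Join (Join x y) z) (Join x (Join y z)),
     Eq (Meet x y) (Meet y x),
     Eq (Join x y) (Join y x),
     Eq (Meet x (Join x y)) x,
     Eq (Join x (Meet x y)) x,
     Le Bot x,
     Le x Top,
     FAnd (FImp (Le (Meet z x) y) (Le z (Imp x y)))
          (FImp (Le z (Imp x y)) (Le (Meet z x) y))})"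

lemma models_heyting_theory_iff:
  "models H heyting_theory \<longleftrightarrow> heyting_algebra H"
proof
  assume H: "models H heyting_theory"
  then interpret hstructure H
    by (simp add: models_def)
  have ax: "sat H (\<lambda>i. if i = 0 then x else if i = 1 then y else z) \<phi>"
    if "x \<in> carrier H" "y \<in> carrier H" "z \<in> carrier H" "\<phi> \<in> heyting_theory" for x y z \<phi>
    using H that by (simp add: models_def)
  show "heyting_algebra H"
  proof
    fix x y z
    assume c: "x \<in> carrier H" "y \<in> carrier H" "z \<in> carrier H"
    note a = ax[OF c, unfolded heyting_theory_def Let_def]
    show "meet H (meet H x y) z = meet H x (meet H y z)"
      using a[of "Eq (Meet (Meet (Var 0) (Var 1)) (Var 2)) (Meet (Var 0) (Meet (Var 1) (Var 2)))"]
      by simp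
    show "join H (join H x y) z = join H x (join H y z)"
      using a[of "Eq (Join (Join (Var 0) (Var 1)) (Var 2)) (Join (Var 0) (Join (Var 1) (Var 2)))"]
      by simp
    show "hle H (meet H z x) y \<longleftrightarrow> hle H z (imp H x y)"
      using a[of "FAnd (FImp (Le (Meet (Var 2) (Var 0)) (Var 1)) (Le (Var 2) (Imp (Var 0) (Var 1))))
          (FImp (Le (Var 2) (Imp (Var 0) (Var 1))) (Le (Meet (Var 2) (Var 0)) (Var 1)))"]
      by (auto simp: hle_def)
  next
    fix x y
    assume c: "x \<in> carrier H" "y \<in> carrier H"
    note a = ax[OF c c(2), unfolded heyting_theory_def Let_def]
    show "meet H x y = meet H y x"
      using a[of "Eq (Meet (Var 0) (Var 1)) (Meet (Var 1) (Var 0))"] by simp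
    show "join H x y = join H y x"
      using a[of "Eq (Join (Var 0) (Var 1)) (Join (Var 1) (Var 0))"] by simp
    show "meet H x (join H x y) = x"
      using a[of "Eq (Meet (Var 0) (Join (Var 0) (Var 1))) (Var 0)"] by simp
    show "join H x (meet H x y) = x"
      using a[of "Eq (Join (Var 0) (Meet (Var 0) (Var 1))) (Var 0)"] by simp
  next
    fix x
    assume c: "x \<in> carrier H"
    note a = ax[OF c c c, unfolded heyting_theory_def Let_def]
    show "hle H (bot H) x"
      using a[of "Le Bot (Var 0)"] by (simp add: hle_def)
    show "hle H x (top H)"
      using a[of "Le (Var 0) Top"] by (simp add: hle_def)
  qed
next
  assume "heyting_algebra H"
  then interpret heyting_algebra H .
  have "sat H e \<phi>" if e: "\<And>i. e i \<in> carrier H" and "\<phi> \<in> heyting_theory" for e \<phi>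
    using that(2) meet_assoc[OF e e e, of 0 1 2] join_assoc[OF e e e, of 0 1 2]
      meet_comm[OF e e, of 0 1] join_comm[OF e e, of 0 1]
      meet_absorb[OF e e, of 0 1] join_absorb[OF e e, of 0 1]
      bot_least[OF e, of 0] top_greatest[OF e, of 0] residuation[OF e e e, of 2 0 1]
    unfolding heyting_theory_def Let_def hle_def by (elim insertE emptyE) simp_all
  then show "models H heyting_theory"
    by (simp add: models_def hstructure_axioms)
qed

end

theory Submission
  imports Defs
begin

text \<open>
  Let \<open>B\<close> be the set of complemented elements of \<open>H\<close>, and suppose \<open>B \<noteq> H\<close>. Choose \<open>x\<close> minimal
  outside \<open>B\<close>. For \<open>c \<in> B\<close> we have \<open>x = (x \<and> c) \<or> (x \<and> \<not>c)\<close>; as \<open>B\<close> is closed under joins, one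
  of the two parts lies outside \<open>B\<close> and so equals \<open>x\<close> by minimality. Hence every \<open>c \<in> B\<close> is either
  above \<open>x\<close> or disjoint from \<open>x\<close>. Negation injects the elements of the first kind into those of
  the second kind, and \<open>d \<mapsto> d \<or> x\<close> injects the latter into the complement of \<open>B\<close>.
  Thus \<open>|B| \<le> 2 |H - B|\<close>, that is, \<open>|B| \<le> 2/3 |H|\<close>.
\<close>

context heyting_algebra
begin

section \<open>Order and lattice facts\<close>

lemma meet_idem: "x \<in> carrier H \<Longrightarrow> meet H x x = x"
  by (metis join_absorb meet_absorb meet_closed)

lemma hle_refl: "x \<in> carrier H \<Longrightarrow> hle H x x"
  by (simp add: hle_def meet_idem)

lemma hle_antisym: "\<lbrakk>x \<in> carrier H; y \<in> carrier H; hle H x y; hle H y x\<rbrakk> \<Longrightarrow> x = y"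
  by (metis hle_def meet_comm)

lemma hle_trans:
  "\<lbrakk>x \<in> carrier H; y \<in> carrier H; z \<in> carrier H; hle H x y; hle H y z\<rbrakk> \<Longrightarrow> hle H x z"
  by (metis hle_def meet_assoc)

lemma hle_meet1: "\<lbrakk>x \<in> carrier H; y \<in> carrier H\<rbrakk> \<Longrightarrow> hle H (meet H x y) x"
  by (metis hle_def meet_assoc meet_comm meet_idem meet_closed)

lemma hle_join1: "\<lbrakk>x \<in> carrier H; y \<in> carrier H\<rbrakk> \<Longrightarrow> hle H x (join H x y)"
  by (simp add: hle_def meet_absorb)

lemma hle_join2: "\<lbrakk>x \<in> carrier H; y \<in> carrier H\<rbrakk> \<Longrightarrow> hle H y (join H x y)"
  by (metis hle_join1 join_comm)

lemma hle_iff_join: "\<lbrakk>x \<in> carrier H; y \<in> carrier H\<rbrakk> \<Longrightarrow> hle H x y \<longleftrightarrow> join H x y = y"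
  by (metis hle_def join_absorb join_comm meet_absorb meet_comm)

lemma join_least:
  "\<lbrakk>x \<in> carrier H; y \<in> carrier H; z \<in> carrier H; hle H x z; hle H y z\<rbrakk> \<Longrightarrow> hle H (join H x y) z"
  by (metis hle_iff_join join_assoc join_closed)

lemma join_mono_right:
  assumes "x \<in> carrier H" "y \<in> carrier H" "z \<in> carrier H" "hle H y z"
  shows "hle H (join H x y) (join H x z)"
  using assms by (meson hle_join1 hle_join2 hle_trans join_closed join_least)

text \<open>Distributivity holds because meeting with \<open>x\<close> has the right adjoint \<open>imp H x\<close>.\<close>

lemma meet_join_distrib:
  assumes x: "x \<in> carrier H" and y: "y \<in> carrier H" and z: "z \<in> carrier H"
  shows "meet H x (join H y z) = join H (meet H x y) (meet H x z)"
proof (rule hle_antisym)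
  let ?r = "join H (meet H x y) (meet H x z)"
  note closed = x y z meet_closed join_closed imp_closed
  show "meet H x (join H y z) \<in> carrier H" "?r \<in> carrier H"
    by (simp_all add: closed)
  have "hle H (meet H y x) ?r" "hle H (meet H z x) ?r"
    by (metis closed hle_join1 hle_join2 meet_comm)+
  then have "hle H y (imp H x ?r)" "hle H z (imp H x ?r)"
    by (simp_all add: closed residuation)
  then have "hle H (join H y z) (imp H x ?r)"
    by (simp add: closed join_least)
  then have "hle H (meet H (join H y z) x) ?r"
    by (simp add: closed residuation)
  then show "hle H (meet H x (join H y z)) ?r"
    by (metis closed(1-3) join_closed meet_comm)
  have "hle H (meet H x w) (meet H x (join H y z))" if "w \<in> carrier H" "hle H w (join H y z)" for w
    using that unfolding hle_def
    by (metis closed(1-3) join_closed meet_assoc meet_closed meet_comm meet_idem)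
  then show "hle H ?r (meet H x (join H y z))"
    by (intro join_least) (simp_all add: closed hle_join1 hle_join2)
qed

lemma join_bot: "x \<in> carrier H \<Longrightarrow> join H x (bot H) = x"
  by (metis bot_closed bot_least hle_iff_join join_comm)

lemma meet_bot: "x \<in> carrier H \<Longrightarrow> meet H x (bot H) = bot H"
  by (metis bot_closed bot_least hle_def meet_comm)

lemma meet_top: "x \<in> carrier H \<Longrightarrow> meet H x (top H) = x"
  using top_greatest by (simp add: hle_def)

lemma top_unique: "\<lbrakk>x \<in> carrier H; hle H (top H) x\<rbrakk> \<Longrightarrow> x = top H"
  by (meson hle_antisym top_closed top_greatest)

section \<open>Negation and complemented elements\<close>

definition neg :: "'a \<Rightarrow> 'a" where
  "neg x = imp H x (bot H)"

text \<open>Excluded middle is the condition that \<open>ds\<close> counts. Since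
  \<open>neg x\<close> is always disjoint from \<open>x\<close>, it makes \<open>neg x\<close> a
  complement of \<open>x\<close>; conversely any complement suffices, by
  \<open>complementedI\<close>.\<close>

definition complemented :: "'a set" where
  "complemented = {x \<in> carrier H. join H x (neg x) = top H}"

lemma complemented_carrier: "x \<in> complemented \<Longrightarrow> x \<in> carrier H"
  by (simp add: complemented_def)

lemma neg_closed: "x \<in> carrier H \<Longrightarrow> neg x \<in> carrier H"
  by (simp add: neg_def bot_closed imp_closed)

text \<open>Residuation at \<open>bot H\<close>: \<open>neg x\<close> is the largest element
  disjoint from \<open>x\<close>.\<close>

lemma hle_neg_iff:
  assumes "x \<in> carrier H" "y \<in> carrier H"
  shows "hle H y (neg x) \<longleftrightarrow> meet H y x = bot H"
  using assms residuation[of x "bot H" y]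
  by (simp add: neg_def bot_closed) (metis hle_def bot_closed meet_bot meet_closed)

lemma neg_meet: "x \<in> carrier H \<Longrightarrow> meet H (neg x) x = bot H"
  using hle_neg_iff[of x "neg x"] by (simp add: neg_closed hle_refl)

lemma meet_neg: "x \<in> carrier H \<Longrightarrow> meet H x (neg x) = bot H"
  by (metis neg_meet meet_comm neg_closed)

lemma join_neg: "x \<in> complemented \<Longrightarrow> join H x (neg x) = top H"
  by (simp add: complemented_def)

text \<open>Disjointness from \<open>x\<close> puts \<open>y\<close> below \<open>neg x\<close>, so
  \<open>join H x (neg x)\<close> lies above \<open>join H x y\<close>, the top.\<close>

lemma complementedI:
  assumes x: "x \<in> carrier H" and y: "y \<in> carrier H"
    and "meet H y x = bot H" "join H x y = top H"
  shows "x \<in> complemented"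
proof -
  have "hle H (join H x y) (join H x (neg x))"
    using assms(3) x y by (simp add: join_mono_right hle_neg_iff neg_closed)
  then show ?thesis
    using assms by (simp add: complemented_def top_unique join_closed neg_closed)
qed

lemma neg_complemented: "x \<in> complemented \<Longrightarrow> neg x \<in> complemented"
  by (rule complementedI[of _ x])
    (simp_all add: complemented_carrier neg_closed meet_neg join_neg join_comm[of "neg x" x])

text \<open>By absorption and distributivity, \<open>a\<close> and \<open>b\<close> both equal
  \<open>meet H a b\<close>. This yields the injectivity of \<open>neg\<close> and of joining with
  \<open>x\<close>.\<close>

lemma disjoint_join_cancel:
  assumes "a \<in> carrier H" "b \<in> carrier H" "x \<in> carrier H"
    and "meet H a x = bot H" "meet H b x = bot H" "join H a x = join H b x"
  shows "a = b"
proof -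
  have "a = meet H a (join H b x)"
    using assms by (metis meet_absorb)
  also have "\<dots> = meet H a b"
    using assms by (simp add: meet_join_distrib join_bot meet_closed)
  also have "\<dots> = meet H b (join H a x)"
    using assms(1-5) by (simp add: meet_join_distrib join_bot meet_closed meet_comm)
  also have "\<dots> = b"
    using assms by (simp add: meet_absorb)
  finally show ?thesis .
qed

lemma inj_on_neg: "inj_on neg complemented"
proof (rule inj_onI)
  fix a b
  assume "a \<in> complemented" "b \<in> complemented" "neg a = neg b"
  then show "a = b"
    \<comment> \<open>Both \<open>a\<close> and \<open>b\<close> are complements of the one element
      \<open>neg a\<close>, which can be cancelled.\<close>
    using disjoint_join_cancel[of a b "neg a"]
    by (metis complemented_carrier join_neg meet_neg neg_closed)
qed

text \<open>De Morgan supplies the complement, \<open>meet H (neg a) (neg b)\<close>.\<close>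

lemma join_complemented:
  assumes "a \<in> complemented" "b \<in> complemented"
  shows "join H a b \<in> complemented"
proof -
  note ab = assms[THEN complemented_carrier]
  note closed = ab ab[THEN neg_closed] meet_closed join_closed top_closed
  let ?j = "join H a b" and ?n = "meet H (neg a) (neg b)"
  have "meet H ?n a = bot H"
    by (metis ab meet_assoc meet_bot meet_comm neg_closed neg_meet)
  moreover have "meet H ?n b = bot H"
    by (metis ab meet_assoc meet_bot neg_closed neg_meet)
  ultimately have disj: "meet H ?n ?j = bot H"
    by (simp add: closed meet_join_distrib join_bot bot_closed)
  have below_j: "hle H w (join H ?j ?n)" if "w \<in> carrier H" "hle H w ?j" for w
    using that by - (rule hle_trans[of w ?j], simp_all add: closed hle_join1)
  \<comment> \<open>Cutting \<open>neg a\<close> along \<open>b\<close> and \<open>neg b\<close>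
    leaves a piece below \<open>b\<close> and the piece \<open>?n\<close>. As \<open>a\<close> is
    below \<open>?j\<close>, the join of \<open>?j\<close> and \<open>?n\<close> then covers
    \<open>a\<close> and \<open>neg a\<close>, hence the top.\<close>
  have "neg a = meet H (neg a) (join H b (neg b))"
    by (simp add: assms closed join_neg meet_top)
  also have "\<dots> = join H (meet H (neg a) b) ?n"
    by (simp add: closed meet_join_distrib)
  also have "hle H \<dots> (join H ?j ?n)"
  proof (intro join_least)
    have "hle H (meet H (neg a) b) b"
      by (metis ab hle_meet1 meet_comm neg_closed)
    then have "hle H (meet H (neg a) b) ?j"
      by (rule hle_trans[of _ b, rotated 3]) (simp_all add: closed hle_join2)
    then show "hle H (meet H (neg a) b) (join H ?j ?n)"
      by (rule below_j[rotated]) (simp add: closed)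
  qed (simp_all add: closed hle_join2)
  finally have "hle H (neg a) (join H ?j ?n)" .
  moreover have "hle H a (join H ?j ?n)"
    by (simp add: below_j closed hle_join1)
  ultimately have "hle H (join H a (neg a)) (join H ?j ?n)"
    by (simp add: closed join_least)
  then have "join H ?j ?n = top H"
    by (simp add: assms closed join_neg top_unique)
  with disj show ?thesis
    by (intro complementedI[of _ ?n]) (simp_all add: closed)
qed

text \<open>The complement of \<open>x\<close> is \<open>join H d (neg (join H d x))\<close>: its
  second part is disjoint from \<open>x\<close> because \<open>x\<close> lies below
  \<open>join H d x\<close>. Read contrapositively, joining a disjoint \<open>d\<close> to a
  non-complemented \<open>x\<close> stays outside the complemented elements.\<close>

lemma complemented_of_disjoint_join:
  assumes d: "d \<in> carrier H" and x: "x \<in> carrier H" and disj: "meet H d x = bot H"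
    and e: "join H d x \<in> complemented"
  shows "x \<in> complemented"
proof (rule complementedI)
  let ?n = "neg (join H d x)"
  note closed = d x complemented_carrier[OF e] neg_closed[OF complemented_carrier[OF e]]
  show "x \<in> carrier H" "join H d ?n \<in> carrier H"
    by (simp_all add: closed join_closed)
  have "meet H x ?n = meet H (meet H x (join H d x)) ?n"
    by (metis closed(1,2) join_comm meet_absorb)
  also have "\<dots> = bot H"
    by (simp add: closed meet_assoc meet_neg meet_bot)
  finally have "meet H x (join H d ?n) = bot H"
    using disj by (simp add: closed meet_join_distrib meet_comm[of x d] join_bot bot_closed)
  then show "meet H (join H d ?n) x = bot H"
    by (simp add: closed join_closed meet_comm)
  have "join H x (join H d ?n) = join H (join H d x) ?n"
    by (metis closed join_assoc join_comm)
  then show "join H x (join H d ?n) = top H"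
    by (simp add: join_neg e)
qed

section \<open>A minimal non-complemented element and the counting bound\<close>

lemma ex_minimal_not_complemented:
  assumes fin: "finite (carrier H)" and ne: "complemented \<noteq> carrier H"
  obtains x where "x \<in> carrier H" "x \<notin> complemented"
    "\<And>y. \<lbrakk>y \<in> carrier H; hle H y x; y \<notin> complemented\<rbrakk> \<Longrightarrow> y = x"
proof -
  \<comment> \<open>Minimize the size of the down-set: for \<open>y\<close> under \<open>x\<close>,
    \<open>below y\<close> is contained in \<open>below x\<close> and has no fewer elements, so the
    two coincide.\<close>
  define below where "below z = {w \<in> carrier H. hle H w z}" for z
  let ?P = "\<lambda>z. z \<in> carrier H \<and> z \<notin> complemented"
  obtain z where "?P z"
    using ne complemented_carrier by blast
  then obtain x where x: "?P x" and least: "\<And>y. ?P y \<Longrightarrow> card (below x) \<le> card (below y)"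
    using exists_least_iff[of "\<lambda>n. \<exists>z. ?P z \<and> card (below z) = n"]
    by (metis linorder_not_less)
  have "y = x" if y: "y \<in> carrier H" "hle H y x" "y \<notin> complemented" for y
  proof -
    have "below y \<subseteq> below x"
      using x y hle_trans by (auto simp: below_def)
    moreover have "finite (below x)"
      using fin by (simp add: below_def)
    ultimately have "below y = below x"
      using least y by (intro card_seteq) auto
    then have "hle H x y"
      using x hle_refl by (auto simp: below_def)
    then show ?thesis
      using x y hle_antisym by blast
  qed
  with x that show thesis
    by blast
qed

theorem card_complemented_le:
  assumes fin: "finite (carrier H)" and ne: "complemented \<noteq> carrier H"
  shows "3 * card complemented \<le> 2 * card (carrier H)"
proof -
  obtain x where x: "x \<in> carrier H" "x \<notin> complemented"
    and minimal: "\<And>y. \<lbrakk>y \<in> carrier H; hle H y x; y \<notin> complemented\<rbrakk> \<Longrightarrow> y = x"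
    using ex_minimal_not_complemented assms by metis
  define P where "P = {c \<in> complemented. hle H x c}"
  define Q where "Q = {c \<in> complemented. meet H c x = bot H}"
  have sub: "complemented \<subseteq> carrier H"
    using complemented_carrier by blast
  then have finB: "finite complemented"
    using fin finite_subset by blast
  have "c \<in> P \<union> Q" if c: "c \<in> complemented" for c
  proof -
    note closed = x(1) c[THEN complemented_carrier] neg_closed meet_closed
    have "x = join H (meet H x c) (meet H x (neg c))"
      by (metis c closed(1-3) join_neg meet_join_distrib meet_top)
    then have "meet H x c \<notin> complemented \<or> meet H x (neg c) \<notin> complemented"
      using x(2) join_complemented by metis
    then have "meet H x c = x \<or> meet H x (neg c) = x"
      using minimal[of "meet H x c"] minimal[of "meet H x (neg c)"]
      by (auto simp: closed hle_meet1)
    then show ?thesis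
    proof
      assume "meet H x c = x"
      with c show ?thesis
        by (simp add: P_def hle_def)
    next
      assume "meet H x (neg c) = x"
      \<comment> \<open>Here \<open>x\<close> lies below \<open>neg c\<close>, which is disjoint
        from \<open>c\<close>.\<close>
      then have "meet H x c = bot H"
        by (metis closed(1,2) meet_assoc meet_bot neg_closed neg_meet)
      with c show ?thesis
        by (simp add: Q_def meet_comm closed)
    qed
  qed
  then have "complemented = P \<union> Q"
    by (auto simp: P_def Q_def)
  then have B: "card complemented \<le> card P + card Q"
    by (simp add: card_Un_le)
  have "card P \<le> card Q"
  proof (rule card_inj_on_le)
    show "inj_on neg P"
      using inj_on_neg by (rule inj_on_subset) (auto simp: P_def)
    show "neg ` P \<subseteq> Q"
    proof clarify
      fix c
      assume "c \<in> P"
      then have c: "c \<in> complemented" "meet H x c = x"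
        by (simp_all add: P_def hle_def)
      then have "meet H (neg c) x = bot H"
        by (metis complemented_carrier meet_assoc meet_bot meet_comm meet_neg neg_closed x(1))
      with c show "neg c \<in> Q"
        by (simp add: Q_def neg_complemented)
    qed
    show "finite Q"
      using finB by (simp add: Q_def)
  qed
  moreover have "card Q \<le> card (carrier H - complemented)"
  proof (rule card_inj_on_le)
    show "inj_on (\<lambda>d. join H d x) Q"
      using disjoint_join_cancel x(1) sub by (intro inj_onI) (auto simp: Q_def)
    show "(\<lambda>d. join H d x) ` Q \<subseteq> carrier H - complemented"
      using complemented_of_disjoint_join x sub join_closed by (auto simp: Q_def)
    show "finite (carrier H - complemented)"
      using fin by simp
  qed
  moreover have "card (carrier H - complemented) + card complemented = card (carrier H)"
    using card_Diff_subset[OF finB sub] card_mono[OF fin sub] by simp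
  \<comment> \<open>The chain is |B| \<le> |P| + |Q| \<le> 2 |Q| \<le> 2 (|H| - |B|).\<close>
  ultimately show ?thesis
    using B by linarith
qed

section \<open>From cardinalities to degrees of satisfiability\<close>

lemma ds_excluded_middle:
  "ds H 1 (Eq (Join (Var 0) (Neg (Var 0))) Top) = card complemented / card (carrier H)"
proof -
  let ?S = "{a \<in> {..<1} \<rightarrow>\<^sub>E carrier H. sat H a (Eq (Join (Var 0) (Neg (Var 0))) Top)}"
  \<comment> \<open>A 1-tuple is an extensional function on \<open>{0}\<close>; evaluation at
    \<open>0\<close> identifies it with an element, and the restricted constant function is the
    inverse.\<close>
  have "bij_betw (\<lambda>a. a 0) ?S complemented"
    by (rule bij_betwI[where g = "\<lambda>x. \<lambda>i\<in>{..<1}. x"])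
      (auto simp: complemented_def neg_def PiE_iff extensional_def fun_eq_iff restrict_def)
  then show ?thesis
    by (simp add: ds_def bij_betw_same_card)
qed

lemma ds_excluded_middle_gap:
  assumes fin: "finite (carrier H)"
  shows "ds H 1 (Eq (Join (Var 0) (Neg (Var 0))) Top) = 1 \<or>
    ds H 1 (Eq (Join (Var 0) (Neg (Var 0))) Top) \<le> 2 / 3"
proof -
  \<comment> \<open>The quotient is genuine, not the default value \<open>0\<close> of division by
    zero.\<close>
  have pos: "card (carrier H) > 0"
    using fin bot_closed card_gt_0_iff by blast
  show ?thesis
  proof (cases "complemented = carrier H")
    case True
    with pos show ?thesis
      unfolding ds_excluded_middle by simp
  next
    case False
    from card_complemented_le[OF fin this] pos show ?thesis
      unfolding ds_excluded_middle by (simp add: field_simps flip: of_nat_mult)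
  qed
qed

end

theorem theorem2p4:
  shows "(\<forall>H :: 'a hstruct. heyting_algebra H \<and> finite (carrier H) \<longrightarrow>
            ds H 1 (Eq (Join (Var 0) (Neg (Var 0))) Top) = 1 \<or>
            ds H 1 (Eq (Join (Var 0) (Neg (Var 0))) Top) \<le> 2 / 3) \<and>
         finite_sat_gap TYPE('a) heyting_theory 1 (Eq (Join (Var 0) (Neg (Var 0))) Top) (1 / 3)"
  \<comment> \<open>Models of \<open>heyting_theory\<close> are exactly the Heyting algebras and 1 -
    1/3 = 2/3, so one bound serves both conjuncts.\<close>
  using heyting_algebra.ds_excluded_middle_gap
  by (auto simp: finite_sat_gap_def models_heyting_theory_iff)

end
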